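(* Let $(X_i)_{i\in\Gamma}$ be a family of Banach spaces and let $X=\bigoplus_{c_0(\Gamma)}X_i$. If $X$ has $BDP$ (respectively $BHP$, $BSCSP$), then each $X_i$, $i\in\Gamma$, has $BDP$ (respectively $BHP$, $BSCSP$).
   Context: All Banach spaces are real and nontrivial. For a Banach space $E$, $B_E$ is the closed unit ball and $S_E$ the unit sphere. A slice of $B_E$ is a set $S(B_E,x^*,\alpha)=\{x\in B_E: x^*(x)>1-\alpha\}$ with $x^*\in S_{E^*}$ and $\alpha>0$. A convex combination of slices of $B_E$ is a set $\sum_{i=1}^n\lambda_i S_i$ (Minkowski sum), where each $S_i$ is a slice of $B_E$, $\lambda_i\ge 0$ and $\sum_{i=1}^n\lambda_i=1$. $E$ has the Ball Dentable Property ($BDP$) if for every $\varepsilon>0$ there is a slice of $B_E$ with diameter less than $\varepsilon$; the Ball Huskable Property ($BHP$) if for every $\varepsilon>0$ there is a nonempty relatively weakly open subset of $B_E$ with diameter less than $\varepsilon$; the Ball Small Combination of Slice Property ($BSCSP$) if for every $\varepsilon>0$ there is a convex combination of slices of $B_E$ with diameter less than $\varepsilon$. $\bigoplus_{c_0(\Gamma)}X_i$ is the space of families $(x_i)_{i\in\Gamma}$ with $x_i\in X_i$ and $(\|x_i\|)_{i\in\Gamma}\in c_0(\Gamma)$ (i.e. $\{i:\|x_i\|\ge\delta\}$ is finite for every $\delta>0$), with norm $\sup_i\|x_i\|$. *)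

theory Defs
  imports "HOL-Analysis.Analysis" "HOL-Library.Function_Algebras"
begin

instantiation "fun" :: (type, real_vector) real_vector
begin

definition scaleR_fun :: "real \<Rightarrow> ('a \<Rightarrow> 'b) \<Rightarrow> 'a \<Rightarrow> 'b" where
  "scaleR_fun c f = (\<lambda>i. c *\<^sub>R f i)"

instance
  by standard (simp_all add: scaleR_fun_def fun_eq_iff scaleR_add_right scaleR_add_left)

end

text \<open>
  A family of Banach spaces may consist of pairwise different spaces, so it cannot be indexed over
  type-class Banach spaces. A normed space is therefore given by a linear subspace of some real
  vector space, without any norm or topology on the latter, together with a function
  that is a norm on this subspace. Every family of real vector spaces embeds linearly in a
  single one (its direct sum), and the norms of different members are unrelated, so every family
  of Banach spaces is covered. Values of norms and functionals outside of the carrier are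
  irrelevant.
\<close>

record 'a nspace =
  carr :: "'a set"
  nrm :: "'a \<Rightarrow> real"

definition normed_space :: "'a::real_vector nspace \<Rightarrow> bool" where
  "normed_space E \<longleftrightarrow>
     subspace (carr E) \<and>
     (\<forall>x\<in>carr E. 0 \<le> nrm E x \<and> (nrm E x = 0 \<longleftrightarrow> x = 0)) \<and>
     (\<forall>x\<in>carr E. \<forall>c. nrm E (c *\<^sub>R x) = \<bar>c\<bar> * nrm E x) \<and>
     (\<forall>x\<in>carr E. \<forall>y\<in>carr E. nrm E (x + y) \<le> nrm E x + nrm E y)"

definition complete_nspace :: "'a::real_vector nspace \<Rightarrow> bool" where
  "complete_nspace E \<longleftrightarrow>
     (\<forall>u::nat \<Rightarrow> 'a. (\<forall>n. u n \<in> carr E) \<longrightarrow>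
        (\<forall>e>0. \<exists>N. \<forall>m\<ge>N. \<forall>n\<ge>N. nrm E (u m - u n) < e) \<longrightarrow>
        (\<exists>x\<in>carr E. (\<lambda>n. nrm E (u n - x)) \<longlonglongrightarrow> 0))"

definition banach_space :: "'a::real_vector nspace \<Rightarrow> bool" where
  "banach_space E \<longleftrightarrow> normed_space E \<and> complete_nspace E \<and> carr E \<noteq> {0}"

definition unit_ball :: "'a::real_vector nspace \<Rightarrow> 'a set" where
  "unit_ball E = {x \<in> carr E. nrm E x \<le> 1}"

text \<open>The case distinction follows the library's \<^const>\<open>diameter\<close>.\<close>

definition ndiameter :: "'a::real_vector nspace \<Rightarrow> 'a set \<Rightarrow> real" where
  "ndiameter E S = (if S = {} then 0 else SUP (x, y)\<in>S \<times> S. nrm E (x - y))"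

definition dual :: "'a::real_vector nspace \<Rightarrow> ('a \<Rightarrow> real) set" where
  "dual E = {f. (\<forall>x\<in>carr E. \<forall>y\<in>carr E. f (x + y) = f x + f y) \<and>
                (\<forall>x\<in>carr E. \<forall>c. f (c *\<^sub>R x) = c * f x) \<and>
                (\<exists>K. \<forall>x\<in>carr E. \<bar>f x\<bar> \<le> K * nrm E x)}"

definition dual_norm :: "'a::real_vector nspace \<Rightarrow> ('a \<Rightarrow> real) \<Rightarrow> real" where
  "dual_norm E f = (SUP x\<in>unit_ball E. \<bar>f x\<bar>)"

definition dual_sphere :: "'a::real_vector nspace \<Rightarrow> ('a \<Rightarrow> real) set" where
  "dual_sphere E = {f \<in> dual E. dual_norm E f = 1}"

definition weak_topology :: "'a::real_vector nspace \<Rightarrow> 'a topology" where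
  "weak_topology E =
     topology_generated_by {{x \<in> carr E. f x \<in> U} | f U. f \<in> dual E \<and> open U}"

definition slice :: "'a::real_vector nspace \<Rightarrow> ('a \<Rightarrow> real) \<Rightarrow> real \<Rightarrow> 'a set" where
  "slice E f \<alpha> = {x \<in> unit_ball E. f x > 1 - \<alpha>}"

definition is_slice :: "'a::real_vector nspace \<Rightarrow> 'a set \<Rightarrow> bool" where
  "is_slice E S \<longleftrightarrow> (\<exists>f\<in>dual_sphere E. \<exists>\<alpha>>0. S = slice E f \<alpha>)"

definition convex_comb_of_slices :: "'a::real_vector nspace \<Rightarrow> 'a set \<Rightarrow> bool" where
  "convex_comb_of_slices E S \<longleftrightarrow>
     (\<exists>(n::nat) c T. (\<forall>i<n. is_slice E (T i) \<and> 0 \<le> c i) \<and> (\<Sum>i<n. c i) = 1 \<and>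
        S = {(\<Sum>i<n. c i *\<^sub>R x i) | x. \<forall>i<n. x i \<in> T i})"

definition BDP :: "'a::real_vector nspace \<Rightarrow> bool" where
  "BDP E \<longleftrightarrow> (\<forall>\<epsilon>>0. \<exists>S. is_slice E S \<and> ndiameter E S < \<epsilon>)"

definition BHP :: "'a::real_vector nspace \<Rightarrow> bool" where
  "BHP E \<longleftrightarrow>
     (\<forall>\<epsilon>>0. \<exists>W. openin (subtopology (weak_topology E) (unit_ball E)) W \<and> W \<noteq> {} \<and>
        ndiameter E W < \<epsilon>)"

definition BSCSP :: "'a::real_vector nspace \<Rightarrow> bool" where
  "BSCSP E \<longleftrightarrow> (\<forall>\<epsilon>>0. \<exists>S. convex_comb_of_slices E S \<and> ndiameter E S < \<epsilon>)"

text \<open>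
  Families indexed by \<open>\<Gamma>\<close> are represented by functions vanishing outside of \<open>\<Gamma>\<close>. Inserting 0 in
  the supremum only matters if \<open>\<Gamma>\<close> is empty.
\<close>

definition c0_sum :: "'i set \<Rightarrow> ('i \<Rightarrow> 'a::real_vector nspace) \<Rightarrow> ('i \<Rightarrow> 'a) nspace" where
  "c0_sum \<Gamma> X =
     \<lparr> carr = {x. (\<forall>i\<in>\<Gamma>. x i \<in> carr (X i)) \<and> (\<forall>i. i \<notin> \<Gamma> \<longrightarrow> x i = 0) \<and>
                  (\<forall>\<delta>>0. finite {i\<in>\<Gamma>. nrm (X i) (x i) \<ge> \<delta>})},
       nrm = (\<lambda>x. Sup (insert 0 ((\<lambda>i. nrm (X i) (x i)) ` \<Gamma>))) \<rparr>"

text \<open>Type-class Banach spaces are an instance, with the usual diameter.\<close>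

lemma banach_space_UNIV:
  assumes "\<exists>x::'a::banach. x \<noteq> 0"
  shows "banach_space \<lparr>carr = (UNIV::'a set), nrm = norm\<rparr>"
proof -
  have "\<exists>x. (\<lambda>n. norm (u n - x)) \<longlonglongrightarrow> 0"
    if "\<forall>e>0. \<exists>N. \<forall>m\<ge>N. \<forall>n\<ge>N. norm (u m - u n) < e" for u :: "nat \<Rightarrow> 'a"
  proof -
    have "Cauchy u"
      using that by (simp add: Cauchy_def dist_norm)
    then obtain x where "u \<longlonglongrightarrow> x"
      using Cauchy_convergent_iff convergent_def by blast
    then show ?thesis
      using LIM_zero tendsto_norm_zero by blast
  qed
  then show ?thesis
    using assms
    by (auto simp: banach_space_def normed_space_def complete_nspace_def norm_triangle_ineq)
qed

lemma ndiameter_eq_diameter: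
  "ndiameter \<lparr>carr = UNIV, nrm = norm\<rparr> S = diameter S"
  by (simp add: ndiameter_def diameter_def dist_norm)

end

theory Submission imports Defs begin

text \<open>
  Split the sum as \<open>X\<^sub>i \<oplus>\<^sub>\<infinity> Y\<close> and let \<open>B\<close> be the ball of \<open>X\<^sub>i\<close>. For a point \<open>(x, y)\<close> of a subset
  \<open>S\<close> of the ball of the sum, the section \<open>{x' \<in> B. (x', y) \<in> S}\<close> is nonempty and isometric to a
  subset of \<open>S\<close>. Sections of relatively weakly open sets are relatively weakly open. Sections of
  slices are slices, unless the functional vanishes on \<open>X\<^sub>i\<close>, when the section is all of \<open>B\<close>. In a
  convex combination of sections of slices, not all of them are \<open>B\<close> if the diameter is less than 2;
  as soon as one of them is a slice, \<open>B\<close> is itself a slice, so all of them are.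
\<close>

section \<open>Normed spaces\<close>

lemma
  assumes "normed_space E"
  shows normed_subspace: "subspace (carr E)"
    and nrm_nonneg: "x \<in> carr E \<Longrightarrow> 0 \<le> nrm E x"
    and nrm_eq_0_iff: "x \<in> carr E \<Longrightarrow> nrm E x = 0 \<longleftrightarrow> x = 0"
    and nrm_scaleR: "x \<in> carr E \<Longrightarrow> nrm E (c *\<^sub>R x) = \<bar>c\<bar> * nrm E x"
    and nrm_triangle: "x \<in> carr E \<Longrightarrow> y \<in> carr E \<Longrightarrow> nrm E (x + y) \<le> nrm E x + nrm E y"
  using assms by (auto simp: normed_space_def)

lemma nrm_zero: "normed_space E \<Longrightarrow> nrm E 0 = 0"
  using nrm_eq_0_iff[of E 0] normed_subspace[of E] subspace_0 by blast

lemma nrm_diff_le: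
  assumes E: "normed_space E" and x: "x \<in> carr E" and y: "y \<in> carr E"
  shows "nrm E (x - y) \<le> nrm E x + nrm E y"
proof -
  have "(-1) *\<^sub>R y \<in> carr E"
    using normed_subspace[OF E] y by (rule subspace_scale)
  then have "nrm E (x + (-1) *\<^sub>R y) \<le> nrm E x + nrm E ((-1) *\<^sub>R y)"
    using E x by (intro nrm_triangle)
  then show ?thesis
    using nrm_scaleR[OF E y, of "-1"] by simp
qed

lemma zero_in_unit_ball: "normed_space E \<Longrightarrow> 0 \<in> unit_ball E"
  by (simp add: unit_ball_def nrm_zero normed_subspace subspace_0)

lemma unit_ball_subset_carr: "unit_ball E \<subseteq> carr E"
  by (auto simp: unit_ball_def)

lemma uminus_in_unit_ball: "normed_space E \<Longrightarrow> x \<in> unit_ball E \<Longrightarrow> - x \<in> unit_ball E"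
  using nrm_scaleR[of E x "-1"] by (auto simp: unit_ball_def normed_subspace subspace_neg)

lemma convex_unit_ball:
  assumes E: "normed_space E"
  shows "convex (unit_ball E)"
proof (rule convexI)
  fix x y u v assume x: "x \<in> unit_ball E" and y: "y \<in> unit_ball E"
    and uv: "0 \<le> (u::real)" "0 \<le> (v::real)" "u + v = 1"
  have c: "u *\<^sub>R x \<in> carr E" "v *\<^sub>R y \<in> carr E"
    using x y normed_subspace[OF E] by (auto simp: unit_ball_def intro: subspace_scale)
  have "nrm E (u *\<^sub>R x + v *\<^sub>R y) \<le> nrm E (u *\<^sub>R x) + nrm E (v *\<^sub>R y)"
    using E c by (rule nrm_triangle)
  also have "\<dots> = u * nrm E x + v * nrm E y"
    using x y uv by (simp add: nrm_scaleR[OF E] unit_ball_def)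
  also have "\<dots> \<le> 1"
    using x y uv by (intro convex_bound_le) (auto simp: unit_ball_def)
  finally show "u *\<^sub>R x + v *\<^sub>R y \<in> unit_ball E"
    using c normed_subspace[OF E] by (simp add: unit_ball_def subspace_add)
qed

section \<open>Diameters of subsets of the unit ball\<close>

lemma nrm_diff_le_ndiameter:
  assumes E: "normed_space E" and S: "S \<subseteq> unit_ball E" and xy: "x \<in> S" "y \<in> S"
  shows "nrm E (x - y) \<le> ndiameter E S"
proof -
  \<comment> \<open>A real supremum dominates its members only when they are bounded above; inside
    the unit ball 2 is a bound.\<close>
  have "nrm E (a - b) \<le> 2" if "a \<in> S" "b \<in> S" for a b
  proof -
    have "a \<in> unit_ball E" "b \<in> unit_ball E" using that S by auto
    then show ?thesis
      using nrm_diff_le[OF E, of a b] by (simp add: unit_ball_def)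
  qed
  then have "bdd_above ((\<lambda>(x, y). nrm E (x - y)) ` (S \<times> S))"
    by (intro bdd_aboveI[of _ 2]) auto
  then have "(\<lambda>(x, y). nrm E (x - y)) (x, y) \<le> (SUP (x, y)\<in>S \<times> S. nrm E (x - y))"
    using xy by (intro cSUP_upper) auto
  then show ?thesis
    using xy by (auto simp: ndiameter_def)
qed

lemma ndiameter_le:
  assumes "S \<noteq> {}" and "\<And>x y. x \<in> S \<Longrightarrow> y \<in> S \<Longrightarrow> nrm E (x - y) \<le> d"
  shows "ndiameter E S \<le> d"
  using assms by (auto simp: ndiameter_def intro!: cSUP_least)

text \<open>A normalized vector and its negative are at distance 2. This is what prevents a section
  of small diameter from being the whole ball, and it is where nontriviality enters.\<close>

lemma two_le_ndiameter_unit_ball: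
  assumes E: "normed_space E" and nz: "carr E \<noteq> {0}"
  shows "2 \<le> ndiameter E (unit_ball E)"
proof -
  obtain u where u: "u \<in> carr E" "u \<noteq> 0"
    using nz subspace_0[OF normed_subspace[OF E]] by auto
  have pos: "nrm E u > 0"
    using u nrm_nonneg[OF E] nrm_eq_0_iff[OF E] by (metis less_eq_real_def)
  define v where "v = (1 / nrm E u) *\<^sub>R u"
  have v: "v \<in> carr E" "nrm E v = 1"
    using u pos normed_subspace[OF E] by (auto simp: v_def subspace_scale nrm_scaleR[OF E])
  then have vb: "v \<in> unit_ball E" by (simp add: unit_ball_def)
  have "v - - v = 2 *\<^sub>R v" by (simp add: scaleR_2)
  then have "nrm E (v - - v) = 2"
    using v nrm_scaleR[OF E v(1), of 2] by simp
  then show ?thesis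
    using nrm_diff_le_ndiameter[OF E subset_refl vb uminus_in_unit_ball[OF E vb]] by simp
qed

section \<open>Functionals and slices\<close>

lemma
  assumes "f \<in> dual E"
  shows dual_add: "x \<in> carr E \<Longrightarrow> y \<in> carr E \<Longrightarrow> f (x + y) = f x + f y"
    and dual_scaleR: "x \<in> carr E \<Longrightarrow> f (c *\<^sub>R x) = c * f x"
  using assms by (auto simp: dual_def)

lemma bdd_above_dual:
  assumes E: "normed_space E" and f: "f \<in> dual E"
  shows "bdd_above ((\<lambda>x. \<bar>f x\<bar>) ` unit_ball E)"
proof -
  obtain K where K: "\<bar>f x\<bar> \<le> K * nrm E x" if "x \<in> carr E" for x
    using f unfolding dual_def by blast
  \<comment> \<open>The definition of \<open>dual\<close> fixes no sign for \<open>K\<close>, so its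
    absolute value serves as the bound.\<close>
  have "\<bar>f x\<bar> \<le> \<bar>K\<bar>" if "x \<in> unit_ball E" for x
  proof -
    have x: "x \<in> carr E" "nrm E x \<le> 1" using that by (auto simp: unit_ball_def)
    have "\<bar>f x\<bar> \<le> \<bar>K\<bar> * nrm E x"
      using K[OF x(1)] mult_right_mono[OF abs_ge_self[of K] nrm_nonneg[OF E x(1)]] by linarith
    also have "\<dots> \<le> \<bar>K\<bar> * 1"
      using x by (intro mult_left_mono) auto
    finally show ?thesis by simp
  qed
  then show ?thesis by (intro bdd_aboveI[of _ "\<bar>K\<bar>"]) auto
qed

lemma abs_le_dual_norm:
  assumes "normed_space E" "f \<in> dual E" "x \<in> unit_ball E"
  shows "\<bar>f x\<bar> \<le> dual_norm E f"
  unfolding dual_norm_def using assms by (intro cSUP_upper bdd_above_dual)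

text \<open>The dual norm is a supremum of absolute values; since the ball is symmetric, replacing a
  near-maximizer by its negative removes the absolute value.\<close>

lemma less_dual_normE:
  assumes E: "normed_space E" and f: "f \<in> dual E" and r: "r < dual_norm E f"
  obtains x where "x \<in> unit_ball E" "r < f x"
proof -
  obtain x where x: "x \<in> unit_ball E" "r < \<bar>f x\<bar>"
    using r zero_in_unit_ball[OF E] bdd_above_dual[OF E f]
    by (subst (asm) dual_norm_def) (subst (asm) less_cSUP_iff; blast)
  have "f (- x) = - f x"
    using dual_scaleR[OF f, of x "-1"] x unit_ball_subset_carr[of E] by auto
  then show thesis
    using that[of x] that[of "- x"] x uminus_in_unit_ball[OF E x(1)] by linarith
qed

section \<open>Slices and half-spaces of the unit ball\<close>

lemma slice_nonempty:
  assumes E: "normed_space E" and S: "is_slice E S"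
  shows "S \<noteq> {}"
proof -
  obtain f a where f: "f \<in> dual E" "dual_norm E f = 1" and a: "a > 0" "S = slice E f a"
    using S by (auto simp: is_slice_def dual_sphere_def)
  have "1 - a < dual_norm E f" using f a by simp
  then obtain x where "x \<in> unit_ball E" "1 - a < f x"
    using less_dual_normE[OF E f(1)] by blast
  then show ?thesis using a by (auto simp: slice_def)
qed

lemma slice_subset: "is_slice E S \<Longrightarrow> S \<subseteq> unit_ball E"
  by (auto simp: is_slice_def slice_def)

text \<open>The given slice supplies a functional of norm one. It is at least -1 on the ball, hence
  above 1 - 3, so the width 3 already captures everything.\<close>

lemma is_slice_unit_ball:
  assumes E: "normed_space E" and S: "is_slice E S"
  shows "is_slice E (unit_ball E)"
proof -
  obtain f where f: "f \<in> dual_sphere E"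
    using S by (auto simp: is_slice_def)
  then have "- 1 \<le> f x" if "x \<in> unit_ball E" for x
    using abs_le_dual_norm[OF E _ that, of f] by (auto simp: dual_sphere_def)
  then have "unit_ball E = slice E f 3"
    by (force simp: slice_def)
  then show ?thesis
    using f by (auto simp: is_slice_def intro!: bexI[of _ f] exI[of _ 3])
qed

text \<open>A functional of norm zero vanishes on the ball, so its nonempty half-space is all of the
  ball. Otherwise, dividing by the norm \<open>N\<close> turns the half-space into a slice of width
  \<open>1 - t / N\<close>; a point of the half-space shows \<open>t < N\<close>, which makes this
  width positive.\<close>

lemma halfspace_is_slice:
  assumes E: "normed_space E" and g: "g \<in> dual E"
    and ne: "{x \<in> unit_ball E. t < g x} \<noteq> {}"
  shows "is_slice E {x \<in> unit_ball E. t < g x} \<or> {x \<in> unit_ball E. t < g x} = unit_ball E"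
proof (cases "dual_norm E g = 0")
  case True
  then have "g x = 0" if "x \<in> unit_ball E" for x
    using abs_le_dual_norm[OF E g that] by simp
  then show ?thesis using ne by auto
next
  case False
  define N where "N = dual_norm E g"
  have "N \<ge> 0"
    using abs_le_dual_norm[OF E g zero_in_unit_ball[OF E]] by (simp add: N_def)
  then have N: "N > 0" using False by (simp add: N_def)
  define f where "f = (\<lambda>x. g x / N)"
  obtain K where K: "\<bar>g x\<bar> \<le> K * nrm E x" if "x \<in> carr E" for x
    using g unfolding dual_def by blast
  have "\<bar>f x\<bar> \<le> (K / N) * nrm E x" if "x \<in> carr E" for x
    using K[OF that] N by (simp add: f_def divide_right_mono)
  then have fd: "f \<in> dual E"
    using dual_add[OF g] dual_scaleR[OF g]
    by (auto simp: dual_def f_def add_divide_distrib intro!: exI[of _ "K / N"])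
  have "dual_norm E f \<le> 1"
    unfolding dual_norm_def
  proof (rule cSUP_least)
    show "unit_ball E \<noteq> {}" using zero_in_unit_ball[OF E] by auto
    show "\<bar>f x\<bar> \<le> 1" if "x \<in> unit_ball E" for x
      using abs_le_dual_norm[OF E g that] N by (simp add: f_def N_def)
  qed
  \<comment> \<open>If some \<open>r < 1\<close> exceeded the norm of \<open>f\<close>, then
    \<open>r * N < N\<close> would give a point of the ball where \<open>g\<close> exceeds
    \<open>r * N\<close>, that is, where \<open>f\<close> exceeds \<open>r\<close>.\<close>
  moreover have "1 \<le> dual_norm E f"
  proof (rule dense_ge)
    fix r :: real assume "dual_norm E f < r"
    show "1 \<le> r"
    proof (rule ccontr)
      assume "\<not> 1 \<le> r"
      then have "r * N < dual_norm E g" using N by (simp flip: N_def)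
      then obtain x where x: "x \<in> unit_ball E" "r * N < g x"
        using less_dual_normE[OF E g] by blast
      then have "r < f x" using N by (simp add: f_def field_simps)
      then show False
        using abs_le_dual_norm[OF E fd x(1)] \<open>dual_norm E f < r\<close> by linarith
    qed
  qed
  ultimately have fs: "f \<in> dual_sphere E" using fd by (simp add: dual_sphere_def)
  obtain x where x: "x \<in> unit_ball E" "t < g x" using ne by auto
  then have "t < N" using abs_le_dual_norm[OF E g x(1)] by (simp add: N_def)
  then have "1 - t / N > 0" using N by simp
  moreover have "{x \<in> unit_ball E. t < g x} = slice E f (1 - t / N)"
    using N by (auto simp: slice_def f_def divide_less_cancel)
  ultimately have "is_slice E {x \<in> unit_ball E. t < g x}"
    using fs unfolding is_slice_def by blast
  then show ?thesis ..
qed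

lemma topspace_weak_topology: "topspace (weak_topology E) = carr E"
proof -
  \<comment> \<open>The zero functional with \<open>U = UNIV\<close> makes the whole carrier a
    subbasic set.\<close>
  have "(\<lambda>x. 0) \<in> dual E" by (auto simp: dual_def intro!: exI[of _ 0])
  then have "carr E \<in> {{x \<in> carr E. f x \<in> U} | f U. f \<in> dual E \<and> open U}"
    by (intro CollectI exI[of _ "\<lambda>x. 0"] exI[of _ UNIV]) auto
  then have "\<Union>{{x \<in> carr E. f x \<in> U} | f U. f \<in> dual E \<and> open U} = carr E"
    by blast
  then show ?thesis
    by (simp add: weak_topology_def)
qed

section \<open>Sections of the unit ball\<close>

text \<open>\<open>F\<close> stands for the sum and \<open>J\<close> for the isometric inclusion of
  a summand \<open>E\<close>. The assumption \<open>split\<close> is the only trace of the sup norm: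
  a point of the ball has a part \<open>w\<close> such that the summand component can be replaced by
  any point of the ball of \<open>E\<close> without leaving the ball of \<open>F\<close>.\<close>

locale ball_section =
  fixes E :: "'a::real_vector nspace" and F :: "'b::real_vector nspace" and J :: "'a \<Rightarrow> 'b"
  assumes E: "normed_space E" and F: "normed_space F" and nontrivial: "carr E \<noteq> {0}"
    and J_carr: "x \<in> carr E \<Longrightarrow> J x \<in> carr F"
    and J_add: "x \<in> carr E \<Longrightarrow> y \<in> carr E \<Longrightarrow> J (x + y) = J x + J y"
    and J_scaleR: "x \<in> carr E \<Longrightarrow> J (c *\<^sub>R x) = c *\<^sub>R J x"
    and nrm_J: "x \<in> carr E \<Longrightarrow> nrm F (J x) = nrm E x"
    and split: "z \<in> unit_ball F \<Longrightarrow> \<exists>w\<in>carr F. \<exists>x\<in>unit_ball E. z = w + J x \<and>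
          (\<forall>y\<in>unit_ball E. w + J y \<in> unit_ball F)"
begin

lemma J_diff: "x \<in> carr E \<Longrightarrow> y \<in> carr E \<Longrightarrow> J (x - y) = J x - J y"
  using J_add[of x "- y"] J_scaleR[of y "-1"] normed_subspace[OF E] by (simp add: subspace_neg)

lemma J_sum:
  fixes n :: nat
  assumes "\<forall>k<n. x k \<in> carr E"
  shows "J (\<Sum>k<n. c k *\<^sub>R x k) = (\<Sum>k<n. c k *\<^sub>R J (x k))"
  using assms
proof (induction n)
  case 0
  show ?case using J_scaleR[of 0 0] subspace_0[OF normed_subspace[OF E]] by simp
next
  case (Suc n)
  have "(\<Sum>k<n. c k *\<^sub>R x k) \<in> carr E"
    using Suc.prems normed_subspace[OF E] by (auto intro!: subspace_sum subspace_scale)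
  moreover have "c n *\<^sub>R x n \<in> carr E"
    using Suc.prems normed_subspace[OF E] by (auto intro!: subspace_scale)
  ultimately show ?case
    using Suc by (simp add: J_add J_scaleR)
qed

lemma dual_comp_J: "f \<in> dual F \<Longrightarrow> (\<lambda>x. f (J x)) \<in> dual E"
  by (auto simp: dual_def J_add J_scaleR J_carr) (metis J_carr nrm_J)

text \<open>The translated embedding \<open>w + J x\<close> is isometric because \<open>w\<close>
  cancels in differences. \<open>A\<close> may be any nonempty part of the section, which allows
  convex combinations of sections later.\<close>

lemma ndiameter_section_le:
  assumes S: "S \<subseteq> unit_ball F" and A: "A \<subseteq> unit_ball E" "A \<noteq> {}"
    and sub: "\<And>x. x \<in> A \<Longrightarrow> w + J x \<in> S"
  shows "ndiameter E A \<le> ndiameter F S"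
proof (rule ndiameter_le[OF A(2)])
  fix x y assume xy: "x \<in> A" "y \<in> A"
  then have c: "x \<in> carr E" "y \<in> carr E" using A unit_ball_subset_carr by auto
  have "nrm E (x - y) = nrm F ((w + J x) - (w + J y))"
    using c normed_subspace[OF E] by (simp add: nrm_J subspace_diff flip: J_diff)
  also have "\<dots> \<le> ndiameter F S"
    using F S sub[OF xy(1)] sub[OF xy(2)] by (rule nrm_diff_le_ndiameter)
  finally show "nrm E (x - y) \<le> ndiameter F S" .
qed

text \<open>Splitting a point of \<open>T\<close> gives \<open>w\<close>. By additivity, membership
  of \<open>w + J y\<close> in \<open>T\<close> becomes a half-space condition on \<open>y\<close>
  for the functional \<open>f\<close> composed with \<open>J\<close>, with the threshold shifted by
  \<open>f w\<close>. The component \<open>x\<close> of the chosen point satisfies it, so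
  \<open>halfspace_is_slice\<close> applies.\<close>

lemma slice_section:
  assumes T: "is_slice F T"
  obtains w A where "w \<in> carr F" "A \<subseteq> unit_ball E" "A \<noteq> {}"
    "is_slice E A \<or> A = unit_ball E" "\<And>x. x \<in> A \<Longrightarrow> w + J x \<in> T"
proof -
  obtain f a where f: "f \<in> dual F" and Teq: "T = slice F f a"
    using T by (auto simp: is_slice_def dual_sphere_def)
  obtain z where z: "z \<in> T"
    using slice_nonempty[OF F T] by auto
  then have "z \<in> unit_ball F" using slice_subset[OF T] by auto
  then obtain w x where w: "w \<in> carr F" and x: "x \<in> unit_ball E" "z = w + J x"
    and wJ: "\<And>y. y \<in> unit_ball E \<Longrightarrow> w + J y \<in> unit_ball F"
    using split by blast
  have fw: "f (w + J y) = f w + f (J y)" if "y \<in> unit_ball E" for y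
    using that w f unit_ball_subset_carr J_carr by (intro dual_add) auto
  define A where "A = {y \<in> unit_ball E. 1 - a - f w < f (J y)}"
  have "x \<in> A"
    using z x fw[OF x(1)] by (auto simp: Teq slice_def A_def)
  show thesis
  proof
    show "is_slice E A \<or> A = unit_ball E"
      using halfspace_is_slice[OF E dual_comp_J[OF f]] \<open>x \<in> A\<close> by (auto simp: A_def)
    show "w + J y \<in> T" if "y \<in> A" for y
      using that wJ fw by (auto simp: A_def Teq slice_def)
  qed (use w \<open>x \<in> A\<close> in \<open>auto simp: A_def\<close>)
qed

section \<open>Passing dentability and small combinations of slices to the summand\<close>

lemma BDP_section:
  assumes "BDP F"
  shows "BDP E"
  unfolding BDP_def
proof (intro allI impI)
  fix \<epsilon> :: real assume "\<epsilon> > 0"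
  \<comment> \<open>The bound 2 rules out the alternative that the section is the entire
    ball.\<close>
  then obtain T where T: "is_slice F T" "ndiameter F T < min \<epsilon> 2"
    using assms unfolding BDP_def by (metis min_less_iff_conj zero_less_numeral)
  obtain w A where A: "A \<subseteq> unit_ball E" "A \<noteq> {}"
    "is_slice E A \<or> A = unit_ball E" "\<And>x. x \<in> A \<Longrightarrow> w + J x \<in> T"
    using slice_section[OF T(1)] by metis
  have "ndiameter E A \<le> ndiameter F T"
    using slice_subset[OF T(1)] A(1,2,4) by (rule ndiameter_section_le)
  then show "\<exists>S. is_slice E S \<and> ndiameter E S < \<epsilon>"
    using T A two_le_ndiameter_unit_ball[OF E nontrivial] by (intro exI[of _ A]) auto
qed

text \<open>A section is taken in each slice separately, with its own base point \<open>w k\<close>.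
  The convex combination \<open>D\<close> of these sections is then carried into \<open>S\<close> by
  \<open>J\<close> followed by translation by the same combination of the base points.\<close>

lemma BSCSP_section:
  assumes "BSCSP F"
  shows "BSCSP E"
  unfolding BSCSP_def
proof (intro allI impI)
  fix \<epsilon> :: real assume "\<epsilon> > 0"
  then obtain S where S: "convex_comb_of_slices F S" "ndiameter F S < min \<epsilon> 2"
    using assms unfolding BSCSP_def by (metis min_less_iff_conj zero_less_numeral)
  then obtain n :: nat and c T where T: "\<And>k. k < n \<Longrightarrow> is_slice F (T k)"
    and c: "\<And>k. k < n \<Longrightarrow> 0 \<le> c k" "(\<Sum>k<n. c k) = 1"
    and Seq: "S = {(\<Sum>k<n. c k *\<^sub>R x k) | x. \<forall>k<n. x k \<in> T k}"
    unfolding convex_comb_of_slices_def by blast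
  have "\<forall>k. \<exists>w A. k < n \<longrightarrow> A \<subseteq> unit_ball E \<and> A \<noteq> {} \<and>
      (is_slice E A \<or> A = unit_ball E) \<and> (\<forall>x\<in>A. w + J x \<in> T k)"
    using slice_section[OF T] by metis
  then obtain w A where A: "\<And>k. k < n \<Longrightarrow> A k \<subseteq> unit_ball E" "\<And>k. k < n \<Longrightarrow> A k \<noteq> {}"
    "\<And>k. k < n \<Longrightarrow> is_slice E (A k) \<or> A k = unit_ball E"
    "\<And>k x. k < n \<Longrightarrow> x \<in> A k \<Longrightarrow> w k + J x \<in> T k"
    by metis
  define D where "D = {(\<Sum>k<n. c k *\<^sub>R x k) | x. \<forall>k<n. x k \<in> A k}"
  have "\<exists>x. \<forall>k<n. x k \<in> A k"
    using A(2) by (intro exI[of _ "\<lambda>k. SOME x. x \<in> A k"]) (simp add: some_in_eq)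
  then have Dne: "D \<noteq> {}" by (auto simp: D_def)
  have Dsub: "D \<subseteq> unit_ball E"
    using A(1) c by (auto simp: D_def intro!: convex_sum[OF _ convex_unit_ball[OF E]])
  have Ssub: "S \<subseteq> unit_ball F"
    using slice_subset[OF T] c
    by (auto simp: Seq intro!: convex_sum[OF _ convex_unit_ball[OF F]])
  have "(\<Sum>k<n. c k *\<^sub>R w k) + J y \<in> S" if yD: "y \<in> D" for y
  proof -
    obtain x where x: "\<forall>k<n. x k \<in> A k" "y = (\<Sum>k<n. c k *\<^sub>R x k)"
      using yD by (auto simp: D_def)
    then have "J y = (\<Sum>k<n. c k *\<^sub>R J (x k))"
      using A(1) unit_ball_subset_carr[of E] by (auto intro!: J_sum)
    then have "(\<Sum>k<n. c k *\<^sub>R w k) + J y = (\<Sum>k<n. c k *\<^sub>R (w k + J (x k)))"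
      by (simp add: scaleR_add_right sum.distrib)
    then show ?thesis
      using x A(4) unfolding Seq by (intro CollectI exI[of _ "\<lambda>k. w k + J (x k)"]) auto
  qed
  then have le: "ndiameter E D \<le> ndiameter F S"
    using Ssub Dsub Dne by (intro ndiameter_section_le)
  \<comment> \<open>If every section were the ball, constant families, with weights summing to 1,
    would show that \<open>D\<close> is the ball, of diameter at least 2.\<close>
  have "\<exists>k<n. is_slice E (A k)"
  proof (rule ccontr)
    assume "\<not> ?thesis"
    then have ball: "A k = unit_ball E" if "k < n" for k using A(3) that by blast
    have "x \<in> D" if "x \<in> unit_ball E" for x
      using that ball c(2) by (auto simp: D_def simp flip: scaleR_sum_left intro!: exI[of _ "\<lambda>_. x"])
    then have "D = unit_ball E" using Dsub by auto
    then show False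
      using le S(2) two_le_ndiameter_unit_ball[OF E nontrivial] by simp
  qed
  \<comment> \<open>One genuine slice makes the ball a slice too, so both alternatives for each
    \<open>A k\<close> now give slices.\<close>
  then have "is_slice E (unit_ball E)" using is_slice_unit_ball[OF E] by blast
  then have "is_slice E (A k)" if "k < n" for k using A(3)[OF that] by auto
  then have "convex_comb_of_slices E D"
    unfolding convex_comb_of_slices_def using c
    by (intro exI[of _ n] exI[of _ c] exI[of _ A]) (auto simp: D_def)
  then show "\<exists>S. convex_comb_of_slices E S \<and> ndiameter E S < \<epsilon>"
    using le S(2) by auto
qed

section \<open>Weak continuity of translated embeddings and huskability\<close>

lemma continuous_map_weak_section:
  assumes w: "w \<in> carr F"
  shows "continuous_map (weak_topology E) (weak_topology F) (\<lambda>x. w + J x)"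
  unfolding weak_topology_def[of F]
proof (rule continuous_on_generated_topo)
  have wJ: "w + J x \<in> carr F" if "x \<in> carr E" for x
    using normed_subspace[OF F] w J_carr[OF that] by (rule subspace_add)
  fix V assume "V \<in> {{x \<in> carr F. f x \<in> U} | f U. f \<in> dual F \<and> open U}"
  then obtain f U where f: "f \<in> dual F" and U: "open U" "V = {x \<in> carr F. f x \<in> U}"
    by blast
  \<comment> \<open>The preimage of a subbasic set for \<open>f\<close> and \<open>U\<close> is
    subbasic for \<open>f\<close> composed with \<open>J\<close> and the translate of
    \<open>U\<close> by \<open>- f w\<close>.\<close>
  have "open ((+) (- f w) ` U)"
    using U(1) by (rule open_translation)
  moreover have "(\<lambda>x. w + J x) -` V \<inter> carr E = {x \<in> carr E. f (J x) \<in> (+) (- f w) ` U}"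
  proof -
    have "f (J x) \<in> (+) (- f w) ` U \<longleftrightarrow> f (w + J x) \<in> U" if "x \<in> carr E" for x
      using dual_add[OF f w J_carr[OF that]] by (force simp: image_iff)
    then show ?thesis using wJ U by auto
  qed
  ultimately show "openin (weak_topology E) ((\<lambda>x. w + J x) -` V \<inter> topspace (weak_topology E))"
    unfolding topspace_weak_topology
    unfolding weak_topology_def using dual_comp_J[OF f]
    by (intro topology_generated_by_Basis CollectI exI[of _ "\<lambda>x. f (J x)"]
        exI[of _ "(+) (- f w) ` U"]) auto
next
  have "\<Union>{{x \<in> carr F. f x \<in> U} | f U. f \<in> dual F \<and> open U} = carr F"
    using topspace_weak_topology[of F] by (simp add: weak_topology_def)
  then show "(\<lambda>x. w + J x) ` topspace (weak_topology E)
      \<subseteq> \<Union>{{x \<in> carr F. f x \<in> U} | f U. f \<in> dual F \<and> open U}"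
    using w J_carr subspace_add[OF normed_subspace[OF F]]
    by (simp only: topspace_weak_topology) blast
qed

lemma BHP_section:
  assumes "BHP F"
  shows "BHP E"
  unfolding BHP_def
proof (intro allI impI)
  fix \<epsilon> :: real assume "\<epsilon> > 0"
  then obtain W where W: "openin (subtopology (weak_topology F) (unit_ball F)) W" "W \<noteq> {}"
    "ndiameter F W < \<epsilon>"
    using assms unfolding BHP_def by blast
  then obtain V where V: "openin (weak_topology F) V" "W = V \<inter> unit_ball F"
    by (auto simp: openin_subtopology)
  obtain z where z: "z \<in> W" using W by auto
  then obtain w x where w: "w \<in> carr F" and x: "x \<in> unit_ball E" "z = w + J x"
    and wJ: "\<And>y. y \<in> unit_ball E \<Longrightarrow> w + J y \<in> unit_ball F"
    using split V by blast
  \<comment> \<open>This section is relatively weakly open by continuity, and it contains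
    \<open>x\<close> because \<open>z\<close> lies in \<open>V\<close>.\<close>
  define A where "A = {y \<in> carr E. w + J y \<in> V} \<inter> unit_ball E"
  have "openin (weak_topology E) {y \<in> carr E. w + J y \<in> V}"
    using openin_continuous_map_preimage[OF continuous_map_weak_section[OF w] V(1)]
    by (simp add: topspace_weak_topology)
  then have "openin (subtopology (weak_topology E) (unit_ball E)) A"
    unfolding A_def openin_subtopology by blast
  moreover have "A \<noteq> {}"
    using x z V unit_ball_subset_carr by (auto simp: A_def)
  moreover have "ndiameter E A \<le> ndiameter F W"
    by (rule ndiameter_section_le[where w = w])
      (use V wJ \<open>A \<noteq> {}\<close> in \<open>auto simp: A_def\<close>)
  ultimately show "\<exists>W. openin (subtopology (weak_topology E) (unit_ball E)) W \<and> W \<noteq> {} \<and>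
      ndiameter E W < \<epsilon>"
    using W(3) by (intro exI[of _ A]) auto
qed

end

section \<open>The sum as a normed space\<close>

lemma mem_c0_sum:
  "x \<in> carr (c0_sum \<Gamma> X) \<longleftrightarrow> (\<forall>i\<in>\<Gamma>. x i \<in> carr (X i)) \<and> (\<forall>i. i \<notin> \<Gamma> \<longrightarrow> x i = 0) \<and>
     (\<forall>\<delta>>0. finite {i\<in>\<Gamma>. nrm (X i) (x i) \<ge> \<delta>})"
  by (simp add: c0_sum_def)

lemma finite_ge_c0_sum:
  "x \<in> carr (c0_sum \<Gamma> X) \<Longrightarrow> \<delta> > 0 \<Longrightarrow> finite {i\<in>\<Gamma>. nrm (X i) (x i) \<ge> \<delta>}"
  by (simp add: c0_sum_def)

text \<open>Only finitely many coordinates have norm at least 1, and the others are bounded by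
  1.\<close>

lemma bdd_above_c0_sum:
  assumes "x \<in> carr (c0_sum \<Gamma> X)"
  shows "bdd_above (insert 0 ((\<lambda>i. nrm (X i) (x i)) ` \<Gamma>))"
proof -
  have "finite {i\<in>\<Gamma>. nrm (X i) (x i) \<ge> 1}"
    using assms by (intro finite_ge_c0_sum) auto
  then have "bdd_above ((\<lambda>i. nrm (X i) (x i)) ` {i\<in>\<Gamma>. nrm (X i) (x i) \<ge> 1})"
    by simp
  moreover have "bdd_above ((\<lambda>i. nrm (X i) (x i)) ` {i\<in>\<Gamma>. \<not> nrm (X i) (x i) \<ge> 1})"
    by (rule bdd_aboveI[of _ 1]) auto
  ultimately have "bdd_above ((\<lambda>i. nrm (X i) (x i)) `
      ({i\<in>\<Gamma>. nrm (X i) (x i) \<ge> 1} \<union> {i\<in>\<Gamma>. \<not> nrm (X i) (x i) \<ge> 1}))"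
    by (simp add: image_Un)
  moreover have "{i\<in>\<Gamma>. nrm (X i) (x i) \<ge> 1} \<union> {i\<in>\<Gamma>. \<not> nrm (X i) (x i) \<ge> 1} = \<Gamma>"
    by auto
  ultimately show ?thesis by simp
qed

text \<open>This reduces norm estimates in the sum to coordinatewise ones; the condition on the sign
  of \<open>r\<close> comes from the inserted 0.\<close>

lemma nrm_c0_sum_le_iff:
  assumes "x \<in> carr (c0_sum \<Gamma> X)"
  shows "nrm (c0_sum \<Gamma> X) x \<le> r \<longleftrightarrow> 0 \<le> r \<and> (\<forall>i\<in>\<Gamma>. nrm (X i) (x i) \<le> r)"
  using cSup_le_iff[OF _ bdd_above_c0_sum[OF assms], of r] by (simp add: c0_sum_def)

lemma
  assumes "x \<in> carr (c0_sum \<Gamma> X)"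
  shows nrm_c0_sum_nonneg: "0 \<le> nrm (c0_sum \<Gamma> X) x"
    and nrm_component_le: "i \<in> \<Gamma> \<Longrightarrow> nrm (X i) (x i) \<le> nrm (c0_sum \<Gamma> X) x"
  using nrm_c0_sum_le_iff[OF assms] by blast+

lemma normed_space_c0_sum:
  assumes X: "\<And>i. i \<in> \<Gamma> \<Longrightarrow> normed_space (X i)"
  shows "normed_space (c0_sum \<Gamma> X)"
proof -
  let ?F = "c0_sum \<Gamma> X"
  have zero: "0 \<in> carr ?F"
  proof -
    have "{i\<in>\<Gamma>. nrm (X i) 0 \<ge> \<delta>} = {}" if "\<delta> > 0" for \<delta>
      using X that by (auto simp: nrm_zero)
    then have "finite {i\<in>\<Gamma>. nrm (X i) 0 \<ge> \<delta>}" if "\<delta> > 0" for \<delta>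
      using that by (metis finite.emptyI)
    then show ?thesis
      using X by (simp add: mem_c0_sum normed_subspace subspace_0)
  qed
  have add: "x + y \<in> carr ?F" if x: "x \<in> carr ?F" and y: "y \<in> carr ?F" for x y
    unfolding mem_c0_sum
  proof (intro conjI allI ballI impI)
    show "(x + y) i \<in> carr (X i)" if "i \<in> \<Gamma>" for i
      using x y X[OF that] that by (auto simp: mem_c0_sum normed_subspace subspace_add)
    show "(x + y) i = 0" if "i \<notin> \<Gamma>" for i
      using x y that by (auto simp: mem_c0_sum)
    fix \<delta> :: real assume "\<delta> > 0"
    \<comment> \<open>Where the sum has norm at least \<delta>, one of the summands has norm at
      least \<delta>/2.\<close>
    then have "finite ({i\<in>\<Gamma>. nrm (X i) (x i) \<ge> \<delta>/2} \<union> {i\<in>\<Gamma>. nrm (X i) (y i) \<ge> \<delta>/2})"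
      using x y by (intro finite_UnI finite_ge_c0_sum) auto
    moreover have "{i\<in>\<Gamma>. nrm (X i) ((x + y) i) \<ge> \<delta>} \<subseteq>
        {i\<in>\<Gamma>. nrm (X i) (x i) \<ge> \<delta>/2} \<union> {i\<in>\<Gamma>. nrm (X i) (y i) \<ge> \<delta>/2}"
    proof
      fix i assume i: "i \<in> {i\<in>\<Gamma>. nrm (X i) ((x + y) i) \<ge> \<delta>}"
      then have "nrm (X i) (x i + y i) \<le> nrm (X i) (x i) + nrm (X i) (y i)"
        using X x y by (intro nrm_triangle) (auto simp: mem_c0_sum)
      then show "i \<in> {i\<in>\<Gamma>. nrm (X i) (x i) \<ge> \<delta>/2} \<union> {i\<in>\<Gamma>. nrm (X i) (y i) \<ge> \<delta>/2}"
        using i by auto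
    qed
    ultimately show "finite {i\<in>\<Gamma>. nrm (X i) ((x + y) i) \<ge> \<delta>}"
      using finite_subset by blast
  qed
  have comp_scale: "nrm (X i) ((c *\<^sub>R x) i) = \<bar>c\<bar> * nrm (X i) (x i)"
    if "x \<in> carr ?F" "i \<in> \<Gamma>" for x c i
    using that nrm_scaleR[OF X] by (auto simp: mem_c0_sum scaleR_fun_def)
  have scale: "c *\<^sub>R x \<in> carr ?F" if x: "x \<in> carr ?F" for x c
  proof (cases "c = 0")
    case True
    then show ?thesis using zero by simp
  next
    case False
    show ?thesis
      unfolding mem_c0_sum
    proof (intro conjI allI ballI impI)
      show "(c *\<^sub>R x) i \<in> carr (X i)" if "i \<in> \<Gamma>" for i
        using x X[OF that] that by (auto simp: mem_c0_sum scaleR_fun_def normed_subspace subspace_scale)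
      show "(c *\<^sub>R x) i = 0" if "i \<notin> \<Gamma>" for i
        using x that by (auto simp: mem_c0_sum scaleR_fun_def)
      fix \<delta> :: real assume "\<delta> > 0"
      then have "finite {i\<in>\<Gamma>. nrm (X i) (x i) \<ge> \<delta> / \<bar>c\<bar>}"
        using x False by (intro finite_ge_c0_sum) auto
      moreover have "{i\<in>\<Gamma>. nrm (X i) ((c *\<^sub>R x) i) \<ge> \<delta>} = {i\<in>\<Gamma>. nrm (X i) (x i) \<ge> \<delta> / \<bar>c\<bar>}"
        using False comp_scale[OF x] by (auto simp: field_simps)
      ultimately show "finite {i\<in>\<Gamma>. nrm (X i) ((c *\<^sub>R x) i) \<ge> \<delta>}" by simp
    qed
  qed
  have nz: "nrm ?F x = 0 \<longleftrightarrow> x = 0" if x: "x \<in> carr ?F" for x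
  proof
    assume "nrm ?F x = 0"
    then have "nrm (X i) (x i) \<le> 0" if "i \<in> \<Gamma>" for i
      using nrm_component_le[OF x that] by simp
    then have "x i = 0" for i
      using x nrm_nonneg[OF X] nrm_eq_0_iff[OF X] by (metis mem_c0_sum order_antisym)
    then show "x = 0" by (simp add: fun_eq_iff)
  next
    assume "x = 0"
    then have "nrm ?F x \<le> 0"
      using nrm_c0_sum_le_iff[OF x] nrm_zero[OF X] by simp
    then show "nrm ?F x = 0" using nrm_c0_sum_nonneg[OF x] by simp
  qed
  have scale_le: "nrm ?F (c *\<^sub>R x) \<le> \<bar>c\<bar> * nrm ?F x" if x: "x \<in> carr ?F" for x c
    using nrm_c0_sum_nonneg[OF x] nrm_component_le[OF x] comp_scale[OF x]
    by (auto simp: nrm_c0_sum_le_iff[OF scale[OF x]] intro: mult_left_mono)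
  \<comment> \<open>For nonzero \<open>c\<close>, the reverse inequality is \<open>scale_le\<close>
    applied to the vector \<open>c *\<^sub>R x\<close> and the scalar \<open>1 / c\<close>.\<close>
  have "nrm ?F (c *\<^sub>R x) = \<bar>c\<bar> * nrm ?F x" if x: "x \<in> carr ?F" for x c
  proof (cases "c = 0")
    case True
    then show ?thesis using nz[OF zero] by simp
  next
    case False
    then have "nrm ?F x \<le> \<bar>1 / c\<bar> * nrm ?F (c *\<^sub>R x)"
      using scale_le[OF scale[OF x], of "1 / c" c] by simp
    then show ?thesis
      using False scale_le[OF x, of c] by (simp add: field_simps)
  qed
  moreover have "nrm ?F (x + y) \<le> nrm ?F x + nrm ?F y"
    if x: "x \<in> carr ?F" and y: "y \<in> carr ?F" for x y
    unfolding nrm_c0_sum_le_iff[OF add[OF x y]]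
  proof (intro conjI ballI)
    show "0 \<le> nrm ?F x + nrm ?F y"
      using nrm_c0_sum_nonneg x y by (metis add_nonneg_nonneg)
    fix i assume i: "i \<in> \<Gamma>"
    have "nrm (X i) (x i + y i) \<le> nrm (X i) (x i) + nrm (X i) (y i)"
      using i X x y by (intro nrm_triangle) (auto simp: mem_c0_sum)
    then show "nrm (X i) ((x + y) i) \<le> nrm ?F x + nrm ?F y"
      using nrm_component_le[OF x i] nrm_component_le[OF y i] by simp
  qed
  ultimately show ?thesis
    using zero add scale nz nrm_c0_sum_nonneg by (auto simp: normed_space_def subspace_def)
qed

section \<open>Coordinate embeddings into the sum\<close>

lemma fun_upd_in_c0_sum:
  assumes "x \<in> carr (c0_sum \<Gamma> X)" "i \<in> \<Gamma>" "y \<in> carr (X i)"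
  shows "x(i := y) \<in> carr (c0_sum \<Gamma> X)"
  unfolding mem_c0_sum
proof (intro conjI allI ballI impI)
  fix \<delta> :: real assume "\<delta> > 0"
  \<comment> \<open>Changing coordinate \<open>i\<close> can add at most the index \<open>i\<close>
    to the set of large coordinates.\<close>
  then have "finite (insert i {j\<in>\<Gamma>. nrm (X j) (x j) \<ge> \<delta>})"
    using finite_ge_c0_sum[OF assms(1)] by simp
  then show "finite {j\<in>\<Gamma>. nrm (X j) ((x(i := y)) j) \<ge> \<delta>}"
    by (rule rev_finite_subset) auto
qed (use assms in \<open>auto simp: mem_c0_sum\<close>)

text \<open>The splitting takes \<open>w = z(i := 0)\<close> and \<open>x = z i\<close>. Adding a
  vector supported at \<open>i\<close> to \<open>w\<close> only fills coordinate \<open>i\<close>,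
  and a supremum of norms stays at most 1 when one coordinate is replaced by a point of the unit
  ball.\<close>

lemma ball_section_c0_sum:
  assumes X: "\<And>i. i \<in> \<Gamma> \<Longrightarrow> normed_space (X i)" and i: "i \<in> \<Gamma>" and nz: "carr (X i) \<noteq> {0}"
  shows "ball_section (X i) (c0_sum \<Gamma> X) (\<lambda>x. 0(i := x))"
proof
  let ?F = "c0_sum \<Gamma> X"
  show F: "normed_space ?F" using X by (rule normed_space_c0_sum)
  show E: "normed_space (X i)" using X i .
  show "carr (X i) \<noteq> {0}" by fact
  have zero: "0 \<in> carr ?F" "0 \<in> carr (X i)"
    using normed_subspace[OF F] normed_subspace[OF E] by (auto intro: subspace_0)
  show J: "0(i := x) \<in> carr ?F" if "x \<in> carr (X i)" for x
    using zero(1) i that by (rule fun_upd_in_c0_sum)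
  show "0(i := x + y) = 0(i := x) + 0(i := y)" for x y :: 'b
    by (auto simp: fun_eq_iff)
  show "0(i := c *\<^sub>R x) = c *\<^sub>R 0(i := x)" for c and x :: 'b
    by (auto simp: fun_eq_iff scaleR_fun_def)
  show "nrm ?F (0(i := x)) = nrm (X i) x" if "x \<in> carr (X i)" for x
  proof (rule antisym)
    show "nrm ?F (0(i := x)) \<le> nrm (X i) x"
      using that nrm_nonneg[OF E that] nrm_zero[OF X] by (simp add: nrm_c0_sum_le_iff J)
    show "nrm (X i) x \<le> nrm ?F (0(i := x))"
      using nrm_component_le[OF J[OF that] i] by simp
  qed
  fix z assume "z \<in> unit_ball ?F"
  then have z: "z \<in> carr ?F" "\<forall>j\<in>\<Gamma>. nrm (X j) (z j) \<le> 1"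
    using nrm_c0_sum_le_iff[of z \<Gamma> X 1] by (auto simp: unit_ball_def)
  have eq: "z(i := 0) + 0(i := y) = z(i := y)" for y
    by (auto simp: fun_eq_iff)
  have "z(i := y) \<in> unit_ball ?F" if "y \<in> unit_ball (X i)" for y
  proof -
    have "y \<in> carr (X i)" "nrm (X i) y \<le> 1" using that by (auto simp: unit_ball_def)
    then show ?thesis
      using z fun_upd_in_c0_sum[OF z(1) i] by (auto simp: unit_ball_def nrm_c0_sum_le_iff)
  qed
  moreover have "z i \<in> unit_ball (X i)"
    using z i by (auto simp: unit_ball_def mem_c0_sum)
  ultimately show "\<exists>w\<in>carr ?F. \<exists>x\<in>unit_ball (X i). z = w + 0(i := x) \<and>
      (\<forall>y\<in>unit_ball (X i). w + 0(i := y) \<in> unit_ball ?F)"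
    using fun_upd_in_c0_sum[OF z(1) i zero(2)]
    by (intro bexI[of _ "z(i := 0)"] bexI[of _ "z i"]) (auto simp: eq)
qed

theorem proposition2p18:
  fixes \<Gamma> :: "'i set" and X :: "'i \<Rightarrow> 'a::real_vector nspace"
  assumes "\<And>i. i \<in> \<Gamma> \<Longrightarrow> banach_space (X i)"
  shows "(BDP (c0_sum \<Gamma> X) \<longrightarrow> (\<forall>i\<in>\<Gamma>. BDP (X i))) \<and>
         (BHP (c0_sum \<Gamma> X) \<longrightarrow> (\<forall>i\<in>\<Gamma>. BHP (X i))) \<and>
         (BSCSP (c0_sum \<Gamma> X) \<longrightarrow> (\<forall>i\<in>\<Gamma>. BSCSP (X i)))"
proof -
  have "ball_section (X i) (c0_sum \<Gamma> X) (\<lambda>x. 0(i := x))" if "i \<in> \<Gamma>" for i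
    using assms that by (intro ball_section_c0_sum) (auto simp: banach_space_def)
  then show ?thesis
    using ball_section.BDP_section ball_section.BHP_section ball_section.BSCSP_section by blast
qed

end
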